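(* Let $\alpha$ be a real algebraic number of degree $N>1$, and for $n\ge1$ let $\alpha_n$ denote the $n$th complete quotient of $\alpha$, so that $\alpha=[a_1,\dots,a_{n-1},\alpha_n]$. Then: (i) for every $n\ge1$, $\alpha_n$ has the same discriminant as $\alpha$; (ii) if $\alpha$ is a reduced algebraic irrationality, then $\alpha_n$ is a reduced algebraic irrationality for every $n\ge1$; (iii) for arbitrary such $\alpha$ (not necessarily reduced), $\alpha_n$ is a reduced algebraic irrationality for all sufficiently large $n$.
   Context: Continued fraction algorithm: for irrational real $\alpha$, set $\alpha_1=\alpha$ and, for $n\ge1$, $a_n=\lfloor\alpha_n\rfloor$ and $\alpha_n=a_n+1/\alpha_{n+1}$ with $\alpha_{n+1}>1$. Then $\alpha=[a_1,\dots,a_{n-1},\alpha_n]$, where $[x_1,\dots,x_m]=x_1+\cfrac{1}{x_2+\cfrac{1}{\ddots+\cfrac{1}{x_m}}}$. The discriminant of an algebraic number is the discriminant of its minimal polynomial in $\mathbb Z[x]$ (primitive, irreducible). For an algebraic number $\beta$ of degree $N$, let $\sigma_1(\beta),\dots,\sigma_{N-1}(\beta)$ denote its conjugates different from $\beta$. An algebraic number $\beta$ (in the field $\mathbb Q(\alpha)$) is called a reduced algebraic irrationality if $\beta$ is real, $\beta>1$, and all its conjugates $\sigma_j(\beta)$, $j=1,\dots,N-1$, lie in the open disk $|z+\tfrac12|<\tfrac12$ in $\mathbb C$. *)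

theory Defs
  imports
    Complex_Main
    "HOL-Computational_Algebra.Computational_Algebra"
begin

section \<open>Complete quotients\<close>

text \<open>Indices start at 1, so that the first complete quotient is the number itself; the value at
  index 0 is irrelevant. Division by zero never occurs when the number is irrational.\<close>

definition complete_quotient :: "real \<Rightarrow> nat \<Rightarrow> real" where
  "complete_quotient \<alpha> n = ((\<lambda>x. 1 / (x - of_int \<lfloor>x\<rfloor>)) ^^ (n - 1)) \<alpha>"

definition partial_quotient :: "real \<Rightarrow> nat \<Rightarrow> int" where
  "partial_quotient \<alpha> n = \<lfloor>complete_quotient \<alpha> n\<rfloor>"

fun cfrac_value :: "real list \<Rightarrow> real" where
  "cfrac_value [] = 0"
| "cfrac_value [x] = x"
| "cfrac_value (x # y # zs) = x + 1 / cfrac_value (y # zs)"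

lemma complete_quotient_1: "complete_quotient \<alpha> 1 = \<alpha>"
  by (simp add: complete_quotient_def)

lemma complete_quotient_Suc:
  assumes "n \<ge> 1"
  shows "complete_quotient \<alpha> (Suc n) =
    1 / (complete_quotient \<alpha> n - of_int (partial_quotient \<alpha> n))"
  using assms by (cases n) (simp_all add: complete_quotient_def partial_quotient_def)

lemma complete_quotient_step:
  assumes "n \<ge> 1"
  shows "complete_quotient \<alpha> n =
    of_int (partial_quotient \<alpha> n) + 1 / complete_quotient \<alpha> (Suc n)"
  using assms by (simp add: complete_quotient_Suc)

lemma complete_quotient_irrational:
  assumes "\<alpha> \<notin> \<rat>"
  shows "complete_quotient \<alpha> n \<notin> \<rat>"
proof -
  have step: "1 / (x - of_int \<lfloor>x\<rfloor>) \<notin> \<rat>" if "x \<notin> \<rat>" for x :: real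
  proof
    assume "1 / (x - of_int \<lfloor>x\<rfloor>) \<in> \<rat>"
    hence "inverse (1 / (x - of_int \<lfloor>x\<rfloor>)) + of_int \<lfloor>x\<rfloor> \<in> \<rat>"
      by (intro Rats_add Rats_inverse) auto
    with that show False by simp
  qed
  have "((\<lambda>x. 1 / (x - of_int \<lfloor>x\<rfloor>)) ^^ m) \<alpha> \<notin> \<rat>" for m
    by (induction m) (use assms step in auto)
  thus ?thesis by (simp add: complete_quotient_def)
qed

lemma complete_quotient_gt_1:
  assumes "\<alpha> \<notin> \<rat>" "n \<ge> 1"
  shows "complete_quotient \<alpha> (Suc n) > 1"
proof -
  let ?x = "complete_quotient \<alpha> n"
  have "?x \<noteq> of_int \<lfloor>?x\<rfloor>"
    using complete_quotient_irrational[OF assms(1), of n] by (metis Rats_of_int)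
  hence "?x - of_int \<lfloor>?x\<rfloor> > 0" "?x - of_int \<lfloor>?x\<rfloor> < 1"
    by linarith+
  thus ?thesis
    using assms(2) by (simp add: complete_quotient_Suc partial_quotient_def)
qed

lemma cfrac_value_snoc:
  "cfrac_value (xs @ [a + 1 / y]) = cfrac_value (xs @ [a, y])"
proof (induction xs)
  case (Cons x xs)
  thus ?case by (cases xs) simp_all
qed simp

lemma cfrac_value_complete_quotient:
  assumes "n \<ge> 1"
  shows "cfrac_value (map (\<lambda>k. of_int (partial_quotient \<alpha> k)) [1..<n] @ [complete_quotient \<alpha> n])
    = \<alpha>"
  using assms
proof (induction n rule: dec_induct)
  case base
  show ?case by (simp add: complete_quotient_def)
next
  case (step n)
  let ?xs = "map (\<lambda>k. of_int (partial_quotient \<alpha> k)) [1..<n]"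
  have "cfrac_value (?xs @ [of_int (partial_quotient \<alpha> n), complete_quotient \<alpha> (Suc n)])
    = cfrac_value (?xs @ [complete_quotient \<alpha> n])"
    using step.hyps complete_quotient_step[of n \<alpha>] by (metis cfrac_value_snoc)
  thus ?case using step by simp
qed


section \<open>Minimal polynomials over the integers\<close>

definition is_int_minpoly :: "'a::field_char_0 \<Rightarrow> int poly \<Rightarrow> bool" where
  "is_int_minpoly x p \<longleftrightarrow>
     irreducible p \<and> content p = 1 \<and> lead_coeff p > 0 \<and> poly (map_poly of_int p) x = 0"

definition int_minpoly :: "'a::field_char_0 \<Rightarrow> int poly" where
  "int_minpoly x = (THE p. is_int_minpoly x p)"

definition algebraic_degree :: "'a::field_char_0 \<Rightarrow> nat" where
  "algebraic_degree x = degree (int_minpoly x)"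

lemma of_int_poly_mult:
  "map_poly of_int (p * q) = (map_poly of_int p * map_poly of_int q :: 'a::field_char_0 poly)"
  by (intro poly_eqI) (simp add: coeff_map_poly coeff_mult)

lemma of_int_poly_add:
  "map_poly of_int (p + q) = (map_poly of_int p + map_poly of_int q :: 'a::field_char_0 poly)"
  by (intro poly_eqI) (simp add: coeff_map_poly)

lemma irreducible_dvd_of_root:
  fixes x :: "'a::field_char_0"
  assumes irr: "irreducible p" and p: "poly (map_poly of_int p) x = 0"
    and f: "poly (map_poly of_int f) x = 0"
  shows "p dvd f"
proof -
  let ?R = "\<lambda>g::int poly. g \<noteq> 0 \<and> poly (map_poly of_int g) x = 0"
  have prime: "prime_elem p"
    using irr by (simp add: irreducible_imp_prime_elem_gcd)
  have "?R p" using irr p by auto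
  then obtain m where m: "?R m" and min: "\<And>g. ?R g \<Longrightarrow> degree m \<le> degree g"
    using ex_has_least_nat[of ?R p degree] by blast
  have pos: "degree g > 0" if g: "?R g" for g
  proof (rule ccontr)
    assume "\<not> degree g > 0"
    then obtain c where "g = [:c:]" using degree_eq_zeroE by blast
    thus False using g by (auto simp: map_poly_pCons)
  qed
  have reduce: "\<exists>c s. c \<noteq> 0 \<and> smult c g = m * s" if g: "poly (map_poly of_int g) x = 0" for g
  proof -
    obtain s r where sr: "pseudo_divmod g m = (s, r)" by force
    let ?c = "lead_coeff m ^ (Suc (degree g) - degree m)"
    have eq: "smult ?c g = m * s + r" and r: "r = 0 \<or> degree r < degree m"
      using pseudo_divmod[OF _ sr] m by auto
    have "map_poly of_int (smult ?c g) = (smult (of_int ?c) (map_poly of_int g) :: 'a poly)"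
      by (intro poly_eqI) (simp add: coeff_map_poly)
    hence "poly (map_poly of_int r) x = 0"
      using arg_cong[OF eq, of "\<lambda>h. poly (map_poly of_int h) x"] m g
      by (simp add: of_int_poly_add of_int_poly_mult)
    hence "r = 0" using min[of r] r by force
    thus ?thesis using eq m by (intro exI[of _ ?c] exI[of _ s]) auto
  qed
  have not_const: "\<not> p dvd [:c:]" if "c \<noteq> 0" for c
    using dvd_imp_degree_le[of p "[:c:]"] pos[OF \<open>?R p\<close>] that by auto
  obtain c s where cs: "c \<noteq> 0" "smult c p = m * s" using reduce[OF p] by blast
  have "p dvd m * s" unfolding cs(2)[symmetric] by (simp add: dvd_smult)
  hence "p dvd m \<or> p dvd s" using prime_elem_dvd_multD[OF prime] by blast
  hence "p dvd m"
  proof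
    assume "p dvd s"
    then obtain t where t: "s = p * t" by (rule dvdE)
    have "p * (m * t) = p * [:c:]" using cs(2) t by (simp add: mult_ac)
    hence "m * t = [:c:]" using \<open>?R p\<close> mult_left_cancel by blast
    hence "m dvd [:c:]" by (metis dvd_triv_left)
    hence "degree m \<le> 0" using dvd_imp_degree_le[of m "[:c:]"] cs(1) by simp
    thus ?thesis using pos[OF m] by simp
  qed
  moreover obtain d u where du: "d \<noteq> 0" "smult d f = m * u" using reduce[OF f] by blast
  ultimately have "p dvd [:d:] * f" by simp
  thus "p dvd f" using prime_elem_dvd_multD[OF prime] not_const[OF du(1)] by blast
qed

lemma is_int_minpoly_unique:
  assumes "is_int_minpoly x p" "is_int_minpoly x q"
  shows "p = q"
proof -
  have "p dvd q" "q dvd p"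
    using assms irreducible_dvd_of_root[of _ x] unfolding is_int_minpoly_def by blast+
  hence "normalize p = normalize q" by (rule associatedI)
  thus ?thesis using assms
    by (simp add: is_int_minpoly_def normalize_poly_def unit_factor_int_def
        flip: one_pCons)
qed

lemma is_int_minpoly_exists:
  fixes x :: "'a::field_char_0"
  assumes "algebraic x"
  shows "\<exists>p. is_int_minpoly x p"
proof -
  let ?e = "\<lambda>g. poly (map_poly of_int g) x"
  obtain f where f: "\<And>i. coeff f i \<in> \<int>" "f \<noteq> 0" "poly f x = 0"
    using algebraicE[OF assms] by blast
  have "\<forall>i. \<exists>k. coeff f i = of_int k"
    using f(1) by (blast elim: Ints_cases)
  then obtain g where g: "\<And>i. coeff f i = of_int (g i)"
    by (auto dest: choice)
  let ?G = "Poly (map g [0..<Suc (degree f)])"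
  have G: "map_poly of_int ?G = f"
  proof (rule poly_eqI)
    fix i
    show "coeff (map_poly of_int ?G) i = coeff f i"
      by (cases "i < Suc (degree f)")
        (auto simp: coeff_map_poly nth_default_def g[symmetric] coeff_eq_0 simp del: upt_Suc)
  qed
  have "?G \<noteq> 0" "?e ?G = 0" using G f by auto
  moreover have "h \<noteq> 0 \<Longrightarrow> ?e h = 0 \<Longrightarrow> \<exists>p. prime_elem p \<and> ?e p = 0" for h
  proof (induction h rule: prime_divisors_induct)
    case (unit u)
    then obtain c where "u = [:c:]" "c dvd 1" using is_unit_polyE by blast
    thus ?case using unit by (auto simp: map_poly_pCons)
  next
    case (factor p h)
    thus ?case by (auto simp: of_int_poly_mult)
  qed simp
  ultimately obtain p where p: "prime_elem p" "?e p = 0" by blast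
  let ?p = "if lead_coeff p > 0 then p else - p"
  have p0: "p \<noteq> 0" using p by auto
  have irr: "irreducible p" using p by (simp add: prime_elem_imp_irreducible)
  have deg: "degree p \<noteq> 0"
  proof
    assume "degree p = 0"
    then obtain c where "p = [:c:]" using degree_eq_zeroE by blast
    thus False using p p0 by (auto simp: map_poly_pCons)
  qed
  hence c1: "content p = 1"
    using irr by (simp add: nonconst_poly_irreducible_iff)
  have l0: "lead_coeff p \<noteq> 0" using p0 by simp
  have "prime_elem (- p)" using p(1) by (simp add: prime_elem_def)
  hence "irreducible ?p" using irr by (simp add: prime_elem_imp_irreducible)
  moreover have "content ?p = 1" using c1 content_smult[of "-1" p] by simp
  moreover have "lead_coeff ?p > 0"
    using l0 by (cases "lead_coeff p" "0 :: int" rule: linorder_cases) simp_all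
  moreover have "map_poly of_int (- p) = (- map_poly of_int p :: 'a poly)"
    by (intro poly_eqI) (simp add: coeff_map_poly)
  hence "?e ?p = 0" using p(2) by simp
  ultimately show ?thesis unfolding is_int_minpoly_def by blast
qed

lemma is_int_minpoly_int_minpoly:
  assumes "algebraic x"
  shows "is_int_minpoly x (int_minpoly x)"
  unfolding int_minpoly_def
  using is_int_minpoly_exists[OF assms] is_int_minpoly_unique by (metis theI)


section \<open>Discriminants\<close>

text \<open>For a polynomial with leading coefficient \<open>c\<close> and complex roots \<open>r\<^sub>1, \<dots>, r\<^sub>N\<close>
  (listed with multiplicity) this is \<open>c\<^bsup>2N-2\<^esup> \<cdot> (\<Prod>i<j. (r\<^sub>i - r\<^sub>j)\<^sup>2)\<close>;
  the value does not depend on the chosen enumeration of the roots.\<close>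

definition poly_discriminant :: "complex poly \<Rightarrow> complex" where
  "poly_discriminant p =
     (let rs = (SOME rs. mset rs = proots p)
      in lead_coeff p ^ (2 * degree p - 2) *
         (\<Prod>(i, j) \<in> {(i, j). i < j \<and> j < length rs}. (rs ! i - rs ! j)\<^sup>2))"

definition algebraic_discriminant :: "'a::field_char_0 \<Rightarrow> complex" where
  "algebraic_discriminant x = poly_discriminant (map_poly of_int (int_minpoly x))"


section \<open>Reduced algebraic irrationalities\<close>

definition other_conjugates :: "real \<Rightarrow> complex set" where
  "other_conjugates \<beta> = {z. poly (map_poly of_int (int_minpoly \<beta>)) z = 0} - {complex_of_real \<beta>}"

inductive_set rat_adjoin :: "real \<Rightarrow> real set" for \<alpha> where
  generator: "\<alpha> \<in> rat_adjoin \<alpha>"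
| rational: "x \<in> \<rat> \<Longrightarrow> x \<in> rat_adjoin \<alpha>"
| add: "x \<in> rat_adjoin \<alpha> \<Longrightarrow> y \<in> rat_adjoin \<alpha> \<Longrightarrow> x + y \<in> rat_adjoin \<alpha>"
| mult: "x \<in> rat_adjoin \<alpha> \<Longrightarrow> y \<in> rat_adjoin \<alpha> \<Longrightarrow> x * y \<in> rat_adjoin \<alpha>"
| inverse: "x \<in> rat_adjoin \<alpha> \<Longrightarrow> inverse x \<in> rat_adjoin \<alpha>"

text \<open>\<open>\<beta>\<close> is a reduced algebraic irrationality in the field \<open>\<rat>(\<alpha>)\<close>.\<close>

definition reduced_irrationality :: "real \<Rightarrow> real \<Rightarrow> bool" where
  "reduced_irrationality \<alpha> \<beta> \<longleftrightarrow>
     \<beta> \<in> rat_adjoin \<alpha> \<and> algebraic \<beta> \<and> \<beta> \<notin> \<rat> \<and> \<beta> > 1 \<and>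
     (\<forall>z \<in> other_conjugates \<beta>. cmod (z + 1 / 2) < 1 / 2)"

end

theory Submission
  imports Defs
begin

text \<open>
  If \<open>p\<close> is the minimal polynomial of \<open>\<beta>\<close>, then up to sign that of \<open>1 / (\<beta> - a)\<close> is the reciprocal
  polynomial of \<open>p(x + a)\<close>. Its leading coefficient is \<open>p(a)\<close> and its roots are \<open>1 / (r - a)\<close>, so
  that the factors \<open>r - a\<close> cancel in the discriminant.

  Reducedness is preserved because inversion maps the half plane \<open>Re w < -1\<close> onto the disk with
  diameter \<open>[-1, 0]\<close>.

  A conjugate \<open>z\<close> of \<open>\<alpha>\<^sub>n\<close> comes from a conjugate \<open>y \<noteq> \<alpha>\<close> of \<open>\<alpha>\<close> via
  \<open>y = (p z + p') / (q z + q')\<close>, where \<open>p/q\<close> and \<open>p'/q'\<close> are consecutive convergents of \<open>\<alpha>\<close>. Hence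
  \<open>\<bar>q y - p\<bar> \<bar>q z + q'\<bar> = 1\<close>. As \<open>\<bar>q \<alpha> - p\<bar> \<le> 1\<close> and \<open>q\<close> tends to infinity, eventually
  \<open>\<bar>q y - p\<bar> > 1\<close>, so that \<open>\<bar>z + q'/q\<bar> < 1/q\<close>. Since \<open>1 \<le> q' \<le> q - 1\<close>, this places \<open>z\<close> in
  that disk.
\<close>

section \<open>Discriminants in terms of lists of roots\<close>

text \<open>A recursive counterpart of the indexed product in \<open>poly_discriminant\<close>, so
  that list induction applies.\<close>

primrec sq_diff_prod :: "'a::comm_ring_1 list \<Rightarrow> 'a" where
  "sq_diff_prod [] = 1"
| "sq_diff_prod (x # xs) = (\<Prod>y\<leftarrow>xs. (x - y)\<^sup>2) * sq_diff_prod xs"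

lemma sq_diff_prod_conv_nth:
  "(\<Prod>(i, j) \<in> {(i, j). i < j \<and> j < length rs}. (rs ! i - rs ! j)\<^sup>2) = sq_diff_prod rs"
proof (induction rs)
  case (Cons x xs)
  let ?S = "{(i, j). i < j \<and> j < length xs}"
  have fin: "finite ?S"
    by (rule finite_subset[of _ "{..<length xs} \<times> {..<length xs}"]) auto
  \<comment> \<open>Pairs with first index 0 give the factors involving the head; the others are
    pairs of the tail with both indices raised by one.\<close>
  have split: "{(i, j). i < j \<and> j < length (x # xs)} =
      (\<lambda>j. (0, Suc j)) ` {..<length xs} \<union> map_prod Suc Suc ` ?S" (is "?L = ?R")
  proof
    show "?L \<subseteq> ?R"
    proof
      fix u assume "u \<in> ?L"
      then obtain i j where u: "u = (i, j)" "i < j" "j < length (x # xs)" by auto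
      then obtain j' where "j = Suc j'" by (cases j) auto
      with u show "u \<in> ?R"
        by (cases i) (auto simp: image_iff map_prod_def)
    qed
  qed auto
  have "(\<Prod>(i, j) \<in> {(i, j). i < j \<and> j < length (x # xs)}. ((x # xs) ! i - (x # xs) ! j)\<^sup>2) =
      (\<Prod>j<length xs. (x - xs ! j)\<^sup>2) * (\<Prod>(i, j) \<in> ?S. (xs ! i - xs ! j)\<^sup>2)"
    unfolding split using fin
    by (subst prod.union_disjoint)
      (auto simp: prod.reindex inj_on_def case_prod_unfold intro!: arg_cong2[of _ _ _ _ "(*)"])
  also have "(\<Prod>j<length xs. (x - xs ! j)\<^sup>2) = (\<Prod>y\<leftarrow>xs. (x - y)\<^sup>2)"
    by (subst prod.list_conv_set_nth) (simp add: atLeast0LessThan)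
  finally show ?case using Cons.IH by simp
qed simp

text \<open>Squaring makes each factor symmetric, so any entry can be moved to the front. This is
  the key to invariance under permutation.\<close>

lemma sq_diff_prod_middle:
  "sq_diff_prod (xs @ x # ys) = (\<Prod>y\<leftarrow>xs @ ys. (x - y)\<^sup>2) * sq_diff_prod (xs @ ys)"
proof (induction xs)
  case (Cons z zs)
  thus ?case using power2_commute[of x z] by (simp add: mult_ac)
qed simp

lemma sq_diff_prod_cong_mset:
  assumes "mset xs = mset ys"
  shows "sq_diff_prod xs = sq_diff_prod ys"
  using assms
proof (induction xs arbitrary: ys)
  case (Cons x xs)
  from Cons.prems have "x \<in> set ys" by (metis list.set_intros(1) mset_eq_setD)
  then obtain us vs where ys: "ys = us @ x # vs" by (meson split_list)
  with Cons.prems have eq: "mset xs = mset (us @ vs)" by simp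
  have "(\<Prod>y\<leftarrow>xs. (x - y)\<^sup>2) = (\<Prod>y\<leftarrow>us @ vs. (x - y)\<^sup>2)"
    using arg_cong[OF eq, of "\<lambda>A. \<Prod>y\<in>#A. (x - y)\<^sup>2"] by (simp flip: prod_mset_prod_list)
  thus ?case using Cons.IH[OF eq] by (simp only: ys sq_diff_prod_middle sq_diff_prod.simps)
qed simp

text \<open>Removes the arbitrary choice made by \<open>SOME\<close>: any enumeration of the roots
  computes the discriminant.\<close>

lemma poly_discriminant_conv_sq_diff_prod:
  assumes "mset rs = proots p"
  shows "poly_discriminant p = lead_coeff p ^ (2 * degree p - 2) * sq_diff_prod rs"
proof -
  have "mset (SOME rs. mset rs = proots p) = proots p"
    using assms by (rule someI)
  thus ?thesis
    unfolding poly_discriminant_def Let_def sq_diff_prod_conv_nth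
    using sq_diff_prod_cong_mset[of "SOME rs. mset rs = proots p" rs] assms by simp
qed

text \<open>The exponent of the leading coefficient is even, so normalising its sign leaves the
  discriminant unchanged.\<close>

lemma poly_discriminant_uminus: "poly_discriminant (- p) = poly_discriminant p"
proof -
  obtain rs where rs: "mset rs = proots p" using ex_mset by blast
  have "even (2 * degree p - 2)" by simp
  thus ?thesis
    using rs by (simp add: poly_discriminant_conv_sq_diff_prod[of rs] power_minus_even)
qed

text \<open>Each factor \<open>1 / (x - a) - 1 / (y - a)\<close> equals
  \<open>(y - x) / ((x - a) * (y - a))\<close>, and every root lies in \<open>length rs - 1\<close>
  pairs. The additional square on both sides avoids a subtraction in the exponent.\<close>

lemma sq_diff_prod_inverse_shift:
  fixes a :: "'a::field"
  assumes "a \<notin> set rs"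
  shows "(\<Prod>r\<leftarrow>rs. a - r) ^ (2 * length rs) * sq_diff_prod (map (\<lambda>r. 1 / (r - a)) rs) =
    (\<Prod>r\<leftarrow>rs. a - r)\<^sup>2 * sq_diff_prod rs"
  using assms
proof (induction rs)
  case (Cons x xs)
  let ?f = "\<lambda>r. 1 / (r - a)" and ?P = "\<Prod>r\<leftarrow>xs. a - r"
  have x: "x \<noteq> a" using Cons.prems by auto
  \<comment> \<open>Clears the denominators of all pairs containing the head \<open>x\<close>: each
    of them contributes \<open>(a - x)^2 * (a - y)^2\<close>.\<close>
  have "(\<Prod>y\<leftarrow>xs. (?f x - ?f y)\<^sup>2) * ((a - x) ^ (2 * length xs) * ?P\<^sup>2) = (\<Prod>y\<leftarrow>xs. (x - y)\<^sup>2)"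
    using Cons.prems
  proof (induction xs)
    case (Cons y ys)
    have "a \<noteq> x" "a \<noteq> y" using Cons.prems by auto
    hence "(?f x - ?f y)\<^sup>2 * ((a - x)\<^sup>2 * (a - y)\<^sup>2) = (x - y)\<^sup>2"
      by (simp add: divide_simps) (simp add: power2_eq_square algebra_simps)
    moreover have "(\<Prod>y\<leftarrow>ys. (?f x - ?f y)\<^sup>2) * ((a - x) ^ (2 * length ys) * (\<Prod>r\<leftarrow>ys. a - r)\<^sup>2)
        = (\<Prod>y\<leftarrow>ys. (x - y)\<^sup>2)"
      using Cons by simp
    ultimately show ?case
      by (simp add: power_mult_distrib power_add mult_ac power2_eq_square)
  qed simp
  hence "(\<Prod>r\<leftarrow>x # xs. a - r)\<^sup>2 * sq_diff_prod (x # xs) =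
     (a - x)\<^sup>2 * ((\<Prod>y\<leftarrow>xs. (?f x - ?f y)\<^sup>2) * ((a - x) ^ (2 * length xs) * ?P\<^sup>2)) *
     (?P\<^sup>2 * sq_diff_prod xs)"
    by (simp add: power_mult_distrib mult_ac)
  also have "?P\<^sup>2 * sq_diff_prod xs = ?P ^ (2 * length xs) * sq_diff_prod (map ?f xs)"
    using Cons by simp
  finally show ?case
    by (auto simp: power_mult_distrib power_add comp_def mult_ac power2_eq_square)
qed simp


section \<open>The substitution \<open>x \<mapsto> a + 1 / x\<close> on polynomials\<close>

text \<open>This is \<open>x ^ degree p * p (a + 1 / x)\<close> written as a polynomial.\<close>

definition inverse_shift_poly :: "'a::comm_ring_1 \<Rightarrow> 'a poly \<Rightarrow> 'a poly" where
  "inverse_shift_poly a p = reflect_poly (pcompose p [:a, 1:])"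

lemma poly_inverse_shift_poly:
  fixes x :: "'a::field"
  assumes "x \<noteq> 0"
  shows "poly (inverse_shift_poly a p) x = x ^ degree p * poly p (a + 1 / x)"
  using assms
  by (simp add: inverse_shift_poly_def poly_reflect_poly_nz poly_pcompose degree_pcompose
      inverse_eq_divide add.commute)

lemma coeff_0_pcompose_shift: "coeff (pcompose p [:a, 1:]) 0 = poly p a"
  by (metis poly_0_coeff_0 poly_pcompose poly_pCons mult_zero_left add.right_neutral)

text \<open>The constant coefficient of the shifted polynomial is \<open>poly p a\<close>; if it is
  nonzero, reversal loses no degree.\<close>

lemma degree_inverse_shift_poly:
  fixes p :: "'a::idom poly"
  assumes "poly p a \<noteq> 0"
  shows "degree (inverse_shift_poly a p) = degree p"
  using assms by (simp add: inverse_shift_poly_def coeff_0_pcompose_shift degree_pcompose)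

lemma lead_coeff_inverse_shift_poly:
  fixes p :: "'a::idom poly"
  assumes "poly p a \<noteq> 0"
  shows "lead_coeff (inverse_shift_poly a p) = poly p a"
  using assms
  by (simp add: inverse_shift_poly_def coeff_0_pcompose_shift degree_pcompose coeff_reflect_poly)

text \<open>The shift keeps the leading coefficient and the reversal moves it to the constant place.
  Hence a nonzero \<open>p\<close> has a nonzero image for which 0 is not a root.\<close>

lemma coeff_0_inverse_shift_poly:
  fixes p :: "'a::idom poly"
  shows "coeff (inverse_shift_poly a p) 0 = lead_coeff p"
  using lead_coeff_comp[of "[:a, 1:]" p]
  by (simp add: inverse_shift_poly_def)

lemma of_int_poly_inverse_shift_poly:
  "map_poly of_int (inverse_shift_poly a p) =
    (inverse_shift_poly (of_int a) (map_poly of_int p) :: 'a::field_char_0 poly)"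
proof -
  have deg: "degree (map_poly of_int q :: 'a poly) = degree q" for q
    by (rule degree_map_poly) simp
  have "map_poly of_int (pcompose p [:a, 1:]) =
      (pcompose (map_poly of_int p) [:of_int a, 1:] :: 'a poly)"
    by (induction p)
      (simp_all add: pcompose_pCons map_poly_pCons of_int_poly_add of_int_poly_mult
        del: mult_pCons_left)
  moreover have "map_poly of_int (reflect_poly q) = (reflect_poly (map_poly of_int q) :: 'a poly)" for q
    by (intro poly_eqI) (simp add: coeff_map_poly coeff_reflect_poly deg)
  ultimately show ?thesis by (simp add: inverse_shift_poly_def)
qed

lemma poly_of_int_poly_of_int:
  "poly (map_poly of_int p) (of_int a) = (of_int (poly p a) :: 'a::field_char_0)"
  by (induction p) (simp_all add: map_poly_pCons)

section \<open>Irreducibility under shift and reversal\<close>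

lemma irreducible_pcompose_shift:
  fixes p :: "'a::idom poly"
  assumes "irreducible p"
  shows "irreducible (pcompose p [:a, 1:])"
proof (rule irreducibleI)
  \<comment> \<open>The shift is a ring automorphism whose inverse is the opposite shift, so it
    transports units and factorisations both ways.\<close>
  have inv: "pcompose (pcompose q [:b, 1:]) [:-b, 1:] = q" for b and q :: "'a poly"
    by (simp add: pcompose_assoc[symmetric] pcompose_pCons)
  have unit: "pcompose q [:b, 1:] dvd 1" if "q dvd 1" for b and q :: "'a poly"
    using that by (metis dvd_def pcompose_1 pcompose_mult)
  show "pcompose p [:a, 1:] \<noteq> 0" using assms inv[of p a] by auto
  show "\<not> pcompose p [:a, 1:] dvd 1"
    using assms unit[of "pcompose p [:a, 1:]" "-a"] inv[of p a] by (auto simp: irreducible_def)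
  fix u v assume "pcompose p [:a, 1:] = u * v"
  hence "p = pcompose u [:-a, 1:] * pcompose v [:-a, 1:]"
    by (metis inv pcompose_mult)
  hence "pcompose u [:-a, 1:] dvd 1 \<or> pcompose v [:-a, 1:] dvd 1"
    by (rule irreducibleD[OF assms])
  thus "u dvd 1 \<or> v dvd 1"
    using unit[of "pcompose u [:-a, 1:]" a] unit[of "pcompose v [:-a, 1:]" a]
      inv[of u "-a"] inv[of v "-a"] by auto
qed

lemma irreducible_reflect_poly:
  fixes p :: "'a::idom poly"
  assumes "irreducible p" "coeff p 0 \<noteq> 0"
  shows "irreducible (reflect_poly p)"
proof (rule irreducibleI)
  have unit: "reflect_poly q dvd 1" if "q dvd 1" for q :: "'a poly"
    using that by (metis dvd_def reflect_poly_1 reflect_poly_mult)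
  show "reflect_poly p \<noteq> 0" using assms by auto
  show "\<not> reflect_poly p dvd 1"
    using assms unit[of "reflect_poly p"] by (auto simp: irreducible_def)
  fix u v assume uv: "reflect_poly p = u * v"
  \<comment> \<open>Reversal is an involution only on polynomials with nonzero constant coefficient,
    so this must be secured for both factors.\<close>
  hence "coeff u 0 * coeff v 0 = lead_coeff p"
    by (metis coeff_0_reflect_poly coeff_mult_0)
  hence nz: "coeff u 0 \<noteq> 0" "coeff v 0 \<noteq> 0" using assms by auto
  have "p = reflect_poly u * reflect_poly v"
    using uv assms(2) by (metis reflect_poly_mult reflect_poly_reflect_poly)
  hence "reflect_poly u dvd 1 \<or> reflect_poly v dvd 1"
    by (rule irreducibleD[OF assms(1)])
  thus "u dvd 1 \<or> v dvd 1"
    using unit[of "reflect_poly u"] unit[of "reflect_poly v"] nz by auto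
qed

section \<open>Roots and discriminant under the substitution\<close>

lemma mset_roots_inverse_shift_poly:
  fixes p :: "complex poly"
  assumes "poly p a \<noteq> 0" "mset rs = proots p"
  shows "mset (map (\<lambda>r. 1 / (r - a)) rs) = proots (inverse_shift_poly a p)"
    and "poly p a = lead_coeff p * (\<Prod>r\<leftarrow>rs. a - r)"
proof -
  have nz: "p \<noteq> 0" using assms by auto
  have p: "p = smult (lead_coeff p) (\<Prod>x\<leftarrow>rs. [:-x, 1:])"
    using complex_poly_decompose_multiset[of p] assms(2)
    by (metis mset_map prod_mset_prod_list)
  have "poly (\<Prod>x\<leftarrow>rs. [:-x, 1:]) a = (\<Prod>r\<leftarrow>rs. a - r)"
    by (induction rs) (simp_all add: algebra_simps)
  thus "poly p a = lead_coeff p * (\<Prod>r\<leftarrow>rs. a - r)" by (metis p poly_smult)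
  have notin: "a \<notin> set rs"
    using assms nz by (metis set_count_proots mem_Collect_eq set_mset_mset)
  \<comment> \<open>A linear factor \<open>X - x\<close> becomes
    \<open>1 + (a - x) X = (a - x) (X - 1 / (x - a))\<close>; multiplicativity then handles the
    whole product.\<close>
  have lin: "proots (inverse_shift_poly a [:-x, 1:]) = {#1 / (x - a)#}" if "x \<noteq> a" for x
  proof -
    have "inverse_shift_poly a [:-x, 1:] = smult (a - x) [:- (1 / (x - a)), 1:]"
      using that by (simp add: inverse_shift_poly_def pcompose_pCons reflect_poly_pCons field_simps)
    moreover have "proots (smult (a - x) [:- (1 / (x - a)), 1:]) = {#1 / (x - a)#}"
      using that proots_smult[of "a - x"] proots_linear_factor by (metis minus_minus right_minus_eq)
    ultimately show ?thesis by simp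
  qed
  have mult: "inverse_shift_poly a (q * r) = inverse_shift_poly a q * inverse_shift_poly a r"
    for q r by (simp add: inverse_shift_poly_def pcompose_mult reflect_poly_mult)
  have nz': "inverse_shift_poly a q \<noteq> 0" if "q \<noteq> 0" for q
    using that coeff_0_inverse_shift_poly[of a q] by auto
  have "proots (inverse_shift_poly a (\<Prod>x\<leftarrow>rs. [:-x, 1:])) = mset (map (\<lambda>r. 1 / (r - a)) rs)"
    using notin
  proof (induction rs)
    case Nil
    show ?case by (simp add: inverse_shift_poly_def pcompose_1)
  next
    case (Cons x xs)
    have "(\<Prod>x\<leftarrow>xs. [:-x, 1:]) \<noteq> 0" by (auto simp: prod_list_zero_iff)
    hence "inverse_shift_poly a (\<Prod>x\<leftarrow>xs. [:-x, 1:]) \<noteq> 0" "inverse_shift_poly a [:-x, 1:] \<noteq> 0"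
      using nz' by auto
    moreover have "x \<noteq> a" using Cons.prems by auto
    ultimately show ?case using Cons lin
      by (simp add: mult proots_mult del: mult_pCons_left)
  qed
  moreover have "inverse_shift_poly a p =
      smult (lead_coeff p) (inverse_shift_poly a (\<Prod>x\<leftarrow>rs. [:-x, 1:]))"
    by (subst p) (simp add: inverse_shift_poly_def pcompose_smult reflect_poly_smult)
  ultimately show "mset (map (\<lambda>r. 1 / (r - a)) rs) = proots (inverse_shift_poly a p)"
    using nz by simp
qed

lemma poly_discriminant_inverse_shift_poly:
  assumes "poly p a \<noteq> 0" "degree p > 0"
  shows "poly_discriminant (inverse_shift_poly a p) = poly_discriminant p"
proof -
  obtain rs where rs: "mset rs = proots p" using ex_mset by blast
  let ?P = "\<Prod>r\<leftarrow>rs. a - r" and ?E = "sq_diff_prod (map (\<lambda>r. 1 / (r - a)) rs)"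
  have len: "length rs = degree p"
    using rs size_proots_complex[of p] by (metis size_mset)
  note roots = mset_roots_inverse_shift_poly[OF assms(1) rs]
  have P: "?P \<noteq> 0" using roots(2) assms(1) by auto
  hence "a \<notin> set rs" by (auto simp: prod_list_zero_iff)
  hence "?P ^ (2 * degree p) * ?E = ?P\<^sup>2 * sq_diff_prod rs"
    using sq_diff_prod_inverse_shift[of a rs] len by simp
  \<comment> \<open>The subtraction is truncated, so this splitting of the exponent uses that the
    degree is positive.\<close>
  moreover have "?P ^ (2 * degree p) = ?P\<^sup>2 * ?P ^ (2 * degree p - 2)"
    using assms(2) by (metis One_nat_def Suc_leI le_add_diff_inverse mult_2_right nat_mult_1_right
      nat_mult_le_cancel_disj one_add_one power_add)
  ultimately have E: "?P ^ (2 * degree p - 2) * ?E = sq_diff_prod rs"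
    using P by simp
  \<comment> \<open>The new leading coefficient \<open>lead_coeff p * ?P\<close> supplies exactly
    the power of \<open>?P\<close> that the squared differences lose.\<close>
  have "poly_discriminant (inverse_shift_poly a p) =
      (lead_coeff p * ?P) ^ (2 * degree p - 2) * ?E"
    by (rule poly_discriminant_conv_sq_diff_prod[OF roots(1),
        unfolded lead_coeff_inverse_shift_poly[OF assms(1)],
        unfolded degree_inverse_shift_poly[OF assms(1)] roots(2)])
  also have "\<dots> = lead_coeff p ^ (2 * degree p - 2) * sq_diff_prod rs"
    by (simp add: power_mult_distrib E mult.assoc)
  also have "\<dots> = poly_discriminant p"
    using poly_discriminant_conv_sq_diff_prod[OF rs] by simp
  finally show ?thesis .
qed


section \<open>One step of the continued fraction algorithm\<close>

lemma irrational_if_algebraic_degree_gt_1: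
  fixes \<alpha> :: real
  assumes "algebraic \<alpha>" "algebraic_degree \<alpha> > 1"
  shows "\<alpha> \<notin> \<rat>"
proof
  assume "\<alpha> \<in> \<rat>"
  then obtain m k :: int where mk: "k \<noteq> 0" "\<alpha> = of_int m / of_int k"
    by (metis Rats_cases' less_irrefl)
  have min: "is_int_minpoly \<alpha> (int_minpoly \<alpha>)"
    using assms(1) by (rule is_int_minpoly_int_minpoly)
  have "poly (map_poly of_int [:-m, k:]) \<alpha> = 0"
    using mk by (simp add: map_poly_pCons)
  hence "int_minpoly \<alpha> dvd [:-m, k:]"
    using min irreducible_dvd_of_root unfolding is_int_minpoly_def by blast
  hence "degree (int_minpoly \<alpha>) \<le> 1"
    using dvd_imp_degree_le[of "int_minpoly \<alpha>" "[:-m, k:]"] mk by simp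
  thus False using assms(2) by (simp add: algebraic_degree_def)
qed

context
  fixes \<beta> :: real and a :: int
  assumes alg: "algebraic \<beta>" and irrat: "\<beta> \<notin> \<rat>"
begin

text \<open>An integer root \<open>a\<close> would make the minimal polynomial divide
  \<open>X - a\<close>, so that \<beta> itself would equal \<open>a\<close>.\<close>

lemma poly_int_minpoly_neq_0: "poly (int_minpoly \<beta>) a \<noteq> 0"
proof
  assume "poly (int_minpoly \<beta>) a = 0"
  hence "poly (map_poly of_int (int_minpoly \<beta>)) (of_int a :: real) = 0"
    by (simp add: poly_of_int_poly_of_int)
  moreover have "poly (map_poly of_int [:-a, 1:]) (of_int a :: real) = 0"
    by (simp add: map_poly_pCons)
  moreover have min: "is_int_minpoly \<beta> (int_minpoly \<beta>)"
    using alg by (rule is_int_minpoly_int_minpoly)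
  ultimately have "int_minpoly \<beta> dvd [:-a, 1:]"
    using irreducible_dvd_of_root unfolding is_int_minpoly_def by blast
  then obtain s where "[:-a, 1:] = int_minpoly \<beta> * s" by (rule dvdE)
  hence "poly (map_poly of_int [:-a, 1:]) \<beta> = 0"
    using min by (simp add: of_int_poly_mult is_int_minpoly_def del: map_poly_pCons)
  hence "\<beta> = of_int a" by (simp add: map_poly_pCons)
  thus False using irrat by simp
qed

lemma degree_int_minpoly_pos: "degree (int_minpoly \<beta>) > 0"
proof (rule ccontr)
  assume "\<not> degree (int_minpoly \<beta>) > 0"
  then obtain c where "int_minpoly \<beta> = [:c:]" using degree_eq_zeroE by blast
  thus False using is_int_minpoly_int_minpoly[OF alg]
    by (auto simp: is_int_minpoly_def map_poly_pCons)
qed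

text \<open>The leading coefficient of the transformed polynomial is the value at \<open>a\<close>,
  so multiplying by its sign makes it positive. Any integer \<open>a\<close> will do; that it is a
  floor matters only for the later size estimates.\<close>

lemma is_int_minpoly_inverse_shift:
  "is_int_minpoly (1 / (\<beta> - of_int a))
     (smult (sgn (poly (int_minpoly \<beta>) a)) (inverse_shift_poly a (int_minpoly \<beta>)))"
    (is "is_int_minpoly ?\<gamma> (smult ?s ?Q)")
proof -
  let ?P = "int_minpoly \<beta>"
  have min: "is_int_minpoly \<beta> ?P" using alg by (rule is_int_minpoly_int_minpoly)
  note nz = poly_int_minpoly_neq_0
  have s: "?s = 1 \<or> ?s = -1" using nz by (auto simp: sgn_if)
  have irr: "irreducible ?Q"
    unfolding inverse_shift_poly_def using min nz
    by (intro irreducible_reflect_poly irreducible_pcompose_shift)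
      (simp_all add: is_int_minpoly_def coeff_0_pcompose_shift)
  hence "content ?Q = 1"
    using degree_int_minpoly_pos degree_inverse_shift_poly[OF nz]
    by (simp add: nonconst_poly_irreducible_iff)
  hence "content (smult ?s ?Q) = 1" using s by (auto simp: content_smult)
  \<comment> \<open>Irreducibility passes to the negative through primality, which covers the sign
    -1.\<close>
  moreover have "prime_elem (- ?Q)"
    using irreducible_imp_prime_elem_gcd[OF irr] by (simp add: prime_elem_def)
  hence "irreducible (smult ?s ?Q)"
    using s irr by (auto simp: prime_elem_imp_irreducible)
  moreover have "lead_coeff (smult ?s ?Q) = \<bar>poly ?P a\<bar>"
    using lead_coeff_inverse_shift_poly[OF nz] by (simp add: lead_coeff_smult abs_sgn mult.commute)
  hence "lead_coeff (smult ?s ?Q) > 0" using nz by simp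
  moreover have "\<beta> \<noteq> of_int a" using irrat by auto
  hence "poly (map_poly of_int ?Q) ?\<gamma> = 0"
    using min by (simp add: of_int_poly_inverse_shift_poly poly_inverse_shift_poly is_int_minpoly_def)
  hence "poly (map_poly of_int (smult ?s ?Q)) ?\<gamma> = 0"
    by (simp add: map_poly_smult)
  ultimately show ?thesis by (simp add: is_int_minpoly_def)
qed

lemma algebraic_inverse_shift: "algebraic (1 / (\<beta> - of_int a))"
  using is_int_minpoly_inverse_shift unfolding is_int_minpoly_def
  by (intro algebraicI[of "map_poly of_int (smult (sgn (poly (int_minpoly \<beta>) a))
      (inverse_shift_poly a (int_minpoly \<beta>)))"]) (auto simp: coeff_map_poly map_poly_eq_0_iff)

lemma int_minpoly_inverse_shift:
  "int_minpoly (1 / (\<beta> - of_int a)) =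
     smult (sgn (poly (int_minpoly \<beta>) a)) (inverse_shift_poly a (int_minpoly \<beta>))"
  using is_int_minpoly_inverse_shift is_int_minpoly_int_minpoly[OF algebraic_inverse_shift]
  by (rule is_int_minpoly_unique[symmetric])

lemma of_int_poly_int_minpoly_inverse_shift:
  obtains "map_poly of_int (int_minpoly (1 / (\<beta> - of_int a))) =
      inverse_shift_poly (of_int a) (map_poly of_int (int_minpoly \<beta>) :: complex poly)"
  | "map_poly of_int (int_minpoly (1 / (\<beta> - of_int a))) =
      - inverse_shift_poly (of_int a) (map_poly of_int (int_minpoly \<beta>) :: complex poly)"
proof -
  have "sgn (poly (int_minpoly \<beta>) a) = 1 \<or> sgn (poly (int_minpoly \<beta>) a) = -1"
    using poly_int_minpoly_neq_0 by (auto simp: sgn_if)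
  moreover have "map_poly of_int (- q) = (- map_poly of_int q :: complex poly)" for q
    by (intro poly_eqI) (simp add: coeff_map_poly)
  ultimately show ?thesis
    using that by (auto simp: int_minpoly_inverse_shift of_int_poly_inverse_shift_poly)
qed

lemma algebraic_discriminant_inverse_shift:
  "algebraic_discriminant (1 / (\<beta> - of_int a)) = algebraic_discriminant \<beta>"
proof -
  let ?P = "map_poly of_int (int_minpoly \<beta>) :: complex poly"
  have "poly ?P (of_int a) = of_int (poly (int_minpoly \<beta>) a)"
    by (rule poly_of_int_poly_of_int)
  hence "poly ?P (of_int a) \<noteq> 0" using poly_int_minpoly_neq_0 by simp
  moreover have "degree ?P > 0"
    using degree_int_minpoly_pos by (simp add: degree_map_poly)
  ultimately have "poly_discriminant (inverse_shift_poly (of_int a) ?P) = poly_discriminant ?P"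
    by (rule poly_discriminant_inverse_shift_poly)
  thus ?thesis
    by (cases rule: of_int_poly_int_minpoly_inverse_shift)
      (simp_all add: algebraic_discriminant_def poly_discriminant_uminus)
qed

text \<open>The sign does not affect roots, and \<open>z\<close> is nonzero because the constant
  coefficient is a leading coefficient. The map from \<open>z\<close> to \<open>a + 1 / z\<close> is
  injective there, so only \<open>1 / (\<beta> - a)\<close> goes to \<beta>.\<close>

lemma other_conjugates_inverse_shift:
  assumes "z \<in> other_conjugates (1 / (\<beta> - of_int a))"
  shows "z \<noteq> 0" "of_int a + 1 / z \<in> other_conjugates \<beta>"
proof -
  let ?P = "map_poly of_int (int_minpoly \<beta>) :: complex poly"
  have z: "poly (inverse_shift_poly (of_int a) ?P) z = 0" "z \<noteq> of_real (1 / (\<beta> - of_int a))"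
    using assms by (cases rule: of_int_poly_int_minpoly_inverse_shift;
        simp add: other_conjugates_def)+
  have "lead_coeff ?P \<noteq> 0"
    using degree_int_minpoly_pos by (auto simp: map_poly_eq_0_iff)
  thus "z \<noteq> 0"
    using z(1) coeff_0_inverse_shift_poly[of "of_int a" ?P] by (auto simp: poly_0_coeff_0)
  hence "poly ?P (of_int a + 1 / z) = 0"
    using z(1) by (simp add: poly_inverse_shift_poly)
  moreover have "of_int a + 1 / z \<noteq> of_real \<beta>"
  proof
    assume "of_int a + 1 / z = of_real \<beta>"
    hence "1 / z = of_real \<beta> - of_int a" by (simp add: algebra_simps)
    hence "z = 1 / (of_real \<beta> - of_int a)"
      using \<open>z \<noteq> 0\<close> by (metis div_by_1 divide_divide_eq_right mult_1)
    thus False using z(2) by simp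
  qed
  ultimately show "of_int a + 1 / z \<in> other_conjugates \<beta>" by (simp add: other_conjugates_def)
qed

end

section \<open>Iteration of the step to all complete quotients\<close>

lemma algebraic_complete_quotient:
  assumes "algebraic \<alpha>" "\<alpha> \<notin> \<rat>" "n \<ge> 1"
  shows "algebraic (complete_quotient \<alpha> n) \<and>
    algebraic_discriminant (complete_quotient \<alpha> n) = algebraic_discriminant \<alpha>"
  using assms(3)
proof (induction n rule: dec_induct)
  case base
  show ?case using assms(1) by (simp add: complete_quotient_1 del: One_nat_def)
next
  case (step n)
  thus ?case
    using complete_quotient_irrational[OF assms(2), of n]
      algebraic_inverse_shift algebraic_discriminant_inverse_shift
    by (simp add: complete_quotient_Suc)
qed

lemma complete_quotient_in_rat_adjoin:
  assumes "n \<ge> 1"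
  shows "complete_quotient \<alpha> n \<in> rat_adjoin \<alpha>"
  using assms
proof (induction n rule: dec_induct)
  case base
  show ?case by (simp add: complete_quotient_1 rat_adjoin.generator del: One_nat_def)
next
  case (step n)
  hence "inverse (complete_quotient \<alpha> n + of_int (- partial_quotient \<alpha> n)) \<in> rat_adjoin \<alpha>"
    using rat_adjoin.inverse rat_adjoin.add rat_adjoin.rational[OF Rats_of_int] by blast
  thus ?case using step.hyps by (simp add: complete_quotient_Suc inverse_eq_divide)
qed

lemma other_conjugates_complete_quotient_Suc:
  assumes "algebraic \<alpha>" "\<alpha> \<notin> \<rat>" "n \<ge> 1" "z \<in> other_conjugates (complete_quotient \<alpha> (Suc n))"
  shows "z \<noteq> 0"
    and "of_int (partial_quotient \<alpha> n) + 1 / z \<in> other_conjugates (complete_quotient \<alpha> n)"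
  using other_conjugates_inverse_shift[of "complete_quotient \<alpha> n" z "partial_quotient \<alpha> n"]
    algebraic_complete_quotient[OF assms(1-3)] complete_quotient_irrational[OF assms(2)] assms(3,4)
  by (simp_all add: complete_quotient_Suc)


section \<open>Conjugates of complete quotients\<close>

lemma reduced_irrationality_complete_quotient:
  assumes "algebraic \<alpha>" "\<alpha> \<notin> \<rat>" "n \<ge> 1" "complete_quotient \<alpha> n > 1"
    "\<And>z. z \<in> other_conjugates (complete_quotient \<alpha> n) \<Longrightarrow> cmod (z + 1 / 2) < 1 / 2"
  shows "reduced_irrationality \<alpha> (complete_quotient \<alpha> n)"
  using assms algebraic_complete_quotient[of \<alpha> n] complete_quotient_irrational[of \<alpha> n]
    complete_quotient_in_rat_adjoin[of n \<alpha>]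
  by (auto simp: reduced_irrationality_def)

text \<open>The assumption amounts to \<open>Re z + |z|^2 < 0\<close>; completing the square gives
  the disk.\<close>

lemma in_disk_if_Re_inverse_less:
  assumes "Re (1 / z) < -1"
  shows "cmod (z + 1 / 2) < 1 / 2"
proof -
  \<comment> \<open>Since \<open>1 / 0 = 0\<close>, the assumption excludes
    \<open>z = 0\<close>.\<close>
  have z: "z \<noteq> 0" using assms by auto
  hence pos: "(Re z)\<^sup>2 + (Im z)\<^sup>2 > 0"
    by (simp add: complex_eq_iff sum_power2_gt_zero_iff)
  have "Re z / ((Re z)\<^sup>2 + (Im z)\<^sup>2) < -1"
    using assms by (simp add: Re_divide)
  hence "Re z + (Re z)\<^sup>2 + (Im z)\<^sup>2 < 0"
    using pos by (simp add: field_simps)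
  moreover have "(cmod (z + 1 / 2))\<^sup>2 = (Re z + 1 / 2)\<^sup>2 + (Im z)\<^sup>2"
    by (simp add: cmod_power2)
  ultimately have "(cmod (z + 1 / 2))\<^sup>2 < (1 / 2)\<^sup>2"
    by (simp add: power2_sum power_divide)
  thus ?thesis by (rule power2_less_imp_less) simp
qed

text \<open>The conjugate \<open>a + 1 / z\<close> of the previous quotient has negative real part,
  and \<open>a \<ge> 1\<close> because that quotient exceeds 1. Thus
  \<open>Re (1 / z) < -1\<close>.\<close>

lemma reduced_irrationality_complete_quotient_Suc:
  assumes "algebraic \<alpha>" "\<alpha> \<notin> \<rat>" "n \<ge> 1" "reduced_irrationality \<alpha> (complete_quotient \<alpha> n)"
  shows "reduced_irrationality \<alpha> (complete_quotient \<alpha> (Suc n))"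
proof (rule reduced_irrationality_complete_quotient)
  show "complete_quotient \<alpha> (Suc n) > 1" by (rule complete_quotient_gt_1) fact+
  fix z assume z: "z \<in> other_conjugates (complete_quotient \<alpha> (Suc n))"
  let ?y = "of_int (partial_quotient \<alpha> n) + 1 / z"
  have "cmod (?y + 1 / 2) < 1 / 2"
    using other_conjugates_complete_quotient_Suc(2)[OF assms(1-3) z] assms(4)
    by (simp add: reduced_irrationality_def)
  hence "Re (?y + 1 / 2) < 1 / 2" using complex_Re_le_cmod[of "?y + 1 / 2"] by linarith
  moreover have "partial_quotient \<alpha> n \<ge> 1"
    using assms(4) by (simp add: reduced_irrationality_def partial_quotient_def le_floor_iff)
  ultimately have "Re (1 / z) < -1" by simp
  thus "cmod (z + 1 / 2) < 1 / 2" by (rule in_disk_if_Re_inverse_less)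
qed (use assms in auto)


section \<open>Convergents\<close>

text \<open>The indices are such that \<open>\<alpha> = (p\<^sub>n \<alpha>\<^sub>n + p\<^bsub>n-1\<^esub>) / (q\<^sub>n \<alpha>\<^sub>n + q\<^bsub>n-1\<^esub>)\<close>, where
  \<open>p\<^sub>n / q\<^sub>n = [a\<^sub>1, \<dots>, a\<^bsub>n-1\<^esub>]\<close> for \<open>n \<ge> 2\<close>.\<close>

fun convergent_num :: "real \<Rightarrow> nat \<Rightarrow> int" where
  "convergent_num \<alpha> 0 = 0"
| "convergent_num \<alpha> (Suc 0) = 1"
| "convergent_num \<alpha> (Suc (Suc n)) =
     partial_quotient \<alpha> (Suc n) * convergent_num \<alpha> (Suc n) + convergent_num \<alpha> n"

fun convergent_den :: "real \<Rightarrow> nat \<Rightarrow> int" where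
  "convergent_den \<alpha> 0 = 1"
| "convergent_den \<alpha> (Suc 0) = 0"
| "convergent_den \<alpha> (Suc (Suc n)) =
     partial_quotient \<alpha> (Suc n) * convergent_den \<alpha> (Suc n) + convergent_den \<alpha> n"

text \<open>The determinant changes sign at each step; the absolute value hides the
  alternation.\<close>

lemma convergent_det:
  "\<bar>convergent_num \<alpha> (Suc n) * convergent_den \<alpha> n -
    convergent_num \<alpha> n * convergent_den \<alpha> (Suc n)\<bar> = 1"
proof (induction n)
  case (Suc n)
  have "convergent_num \<alpha> (Suc (Suc n)) * convergent_den \<alpha> (Suc n) -
      convergent_num \<alpha> (Suc n) * convergent_den \<alpha> (Suc (Suc n)) =
    - (convergent_num \<alpha> (Suc n) * convergent_den \<alpha> n -
      convergent_num \<alpha> n * convergent_den \<alpha> (Suc n))"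
    by (simp add: algebra_simps)
  thus ?case using Suc.IH by linarith
qed simp

lemma partial_quotient_ge_1:
  assumes "\<alpha> \<notin> \<rat>" "n \<ge> 2"
  shows "partial_quotient \<alpha> n \<ge> 1"
proof -
  obtain m where "n = Suc m" "m \<ge> 1" using assms(2) by (cases n) auto
  thus ?thesis
    using complete_quotient_gt_1[OF assms(1), of m] by (simp add: partial_quotient_def le_floor_iff)
qed

text \<open>The denominators start with 1, 0, 1, \<open>a_2\<close>, \<open>a_3 * a_2 + 1\<close>.
  As \<open>a_2\<close> may be 1, strict growth is certain only from index 3 on. The linear lower
  bound serves as divergence to infinity.\<close>

lemma convergent_den_growth:
  assumes "\<alpha> \<notin> \<rat>"
  shows "convergent_den \<alpha> (n + 3) \<ge> 1 \<and> convergent_den \<alpha> (n + 3) < convergent_den \<alpha> (n + 4) \<and>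
    int n < convergent_den \<alpha> (n + 4)"
proof (induction n)
  case 0
  have "partial_quotient \<alpha> 2 \<ge> 1" "partial_quotient \<alpha> 3 \<ge> 1"
    using partial_quotient_ge_1[OF assms] by simp_all
  moreover from this have "partial_quotient \<alpha> 3 * partial_quotient \<alpha> 2 \<ge> partial_quotient \<alpha> 2"
    by simp
  ultimately show ?case by (simp add: numeral_eq_Suc)
next
  case (Suc n)
  let ?q = "convergent_den \<alpha>"
  have rec: "?q (n + 5) = partial_quotient \<alpha> (n + 4) * ?q (n + 4) + ?q (n + 3)"
    by (simp add: numeral_eq_Suc)
  have "partial_quotient \<alpha> (n + 4) * ?q (n + 4) \<ge> 1 * ?q (n + 4)"
    using partial_quotient_ge_1[OF assms, of "n + 4"] Suc.IH by (intro mult_right_mono) auto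
  hence "?q (n + 5) > ?q (n + 4)" using rec Suc.IH by linarith
  thus ?case using Suc.IH by (simp add: add.commute)
qed

section \<open>Conjugates through convergents\<close>

lemma conjugate_conv_convergents:
  assumes "algebraic \<alpha>" "\<alpha> \<notin> \<rat>" "z \<in> other_conjugates (complete_quotient \<alpha> (Suc n))"
  shows "\<exists>y \<in> other_conjugates \<alpha>.
    y * (of_int (convergent_den \<alpha> (Suc n)) * z + of_int (convergent_den \<alpha> n)) =
      of_int (convergent_num \<alpha> (Suc n)) * z + of_int (convergent_num \<alpha> n)"
  using assms(3)
proof (induction n arbitrary: z)
  case 0
  thus ?case by (intro bexI[of _ z]) (simp_all add: complete_quotient_def)
next
  case (Suc n)
  let ?a = "partial_quotient \<alpha> (Suc n)"
  note z = other_conjugates_complete_quotient_Suc[OF assms(1,2) _ Suc.prems]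
  have "z \<noteq> 0" using z(1) by simp
  obtain y where y: "y \<in> other_conjugates \<alpha>"
    "y * (of_int (convergent_den \<alpha> (Suc n)) * (of_int ?a + 1 / z) + of_int (convergent_den \<alpha> n)) =
      of_int (convergent_num \<alpha> (Suc n)) * (of_int ?a + 1 / z) + of_int (convergent_num \<alpha> n)"
    using Suc.IH[OF z(2)] by auto
  \<comment> \<open>Multiplying by \<open>z\<close> clears \<open>1 / z\<close> and produces the
    recurrences for the next convergent.\<close>
  from arg_cong[OF y(2), of "\<lambda>u. z * u"] \<open>z \<noteq> 0\<close>
  show ?case by (intro bexI[OF _ y(1)]) (simp add: algebra_simps)
qed

lemma complete_quotient_conv_convergents:
  assumes "\<alpha> \<notin> \<rat>"
  shows "\<alpha> * (of_int (convergent_den \<alpha> (Suc n)) * complete_quotient \<alpha> (Suc n) +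
      of_int (convergent_den \<alpha> n)) =
    of_int (convergent_num \<alpha> (Suc n)) * complete_quotient \<alpha> (Suc n) + of_int (convergent_num \<alpha> n)"
proof (induction n)
  case 0
  show ?case by (simp add: complete_quotient_def)
next
  case (Suc n)
  let ?z = "complete_quotient \<alpha> (Suc (Suc n))"
  have "?z > 1" by (rule complete_quotient_gt_1) (use assms in auto)
  hence "?z \<noteq> 0" by simp
  with arg_cong[OF Suc.IH[unfolded complete_quotient_step[of "Suc n" \<alpha>, simplified]], of "\<lambda>u. ?z * u"]
  show ?case by (simp add: algebra_simps)
qed

text \<open>By the relation, \<open>(q y - p) (q z + q')\<close> is the determinant up to sign. The
  general field allows use both for the real \<alpha> and for its complex conjugates.\<close>

lemma moebius_norm_mult_eq_1:
  fixes y z :: "'a::real_normed_field" and p p' q q' :: int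
  assumes eq: "y * (of_int q * z + of_int q') = of_int p * z + of_int p'"
    and det: "\<bar>p * q' - p' * q\<bar> = 1"
  shows "norm (of_int q * y - of_int p) * norm (of_int q * z + of_int q') = 1"
proof -
  have "(of_int q * y - of_int p) * (of_int q * z + of_int q') =
      of_int q * (y * (of_int q * z + of_int q')) - of_int p * (of_int q * z + of_int q')"
    by (simp add: algebra_simps)
  also have "\<dots> = - of_int (p * q' - p' * q)"
    unfolding eq by (simp add: algebra_simps)
  finally show ?thesis
    using det by (metis norm_mult norm_minus_cancel norm_of_int of_int_1 of_int_abs)
qed

lemma conjugate_in_disk:
  assumes "algebraic \<alpha>" "\<alpha> \<notin> \<rat>" "z \<in> other_conjugates (complete_quotient \<alpha> (n + 4))"
    and far: "\<And>y. y \<in> other_conjugates \<alpha> \<Longrightarrow> of_nat n * cmod (y - of_real \<alpha>) > 2"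
  shows "cmod (z + 1 / 2) < 1 / 2"
proof -
  define p q p' q' where "p = convergent_num \<alpha> (n + 4)" and "q = convergent_den \<alpha> (n + 4)"
    and "p' = convergent_num \<alpha> (n + 3)" and "q' = convergent_den \<alpha> (n + 3)"
  note pq_defs = p_def q_def p'_def q'_def
  let ?x = "complete_quotient \<alpha> (n + 4)"
  have n4: "n + 4 = Suc (n + 3)" by simp
  have q: "q' \<ge> 1" "q' < q" "int n < q"
    using convergent_den_growth[OF assms(2), of n] by (simp_all add: pq_defs)
  have det: "\<bar>p * q' - p' * q\<bar> = 1"
    unfolding pq_defs n4 by (rule convergent_det)
  obtain y where y: "y \<in> other_conjugates \<alpha>"
    "y * (of_int q * z + of_int q') = of_int p * z + of_int p'"
    using conjugate_conv_convergents[OF assms(1,2) assms(3)[unfolded n4]]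
    unfolding pq_defs n4 by blast
  have "?x > 1" unfolding n4 by (rule complete_quotient_gt_1) (use assms in auto)
  hence "of_int q * ?x \<ge> 1" using q by (intro mult_ge1_I) auto
  hence large: "norm (of_int q * ?x + of_int q') \<ge> 1" using q by simp
  \<comment> \<open>Applied to \<alpha> itself, the identity bounds the approximation error, since
    the other factor is at least 1.\<close>
  have "norm (of_int q * \<alpha> - of_int p) * norm (of_int q * ?x + of_int q') = 1"
    by (rule moebius_norm_mult_eq_1[OF _ det])
      (use complete_quotient_conv_convergents[OF assms(2), of "n + 3"] in
        \<open>simp add: pq_defs n4 del: add_Suc_right\<close>)
  hence "\<bar>of_int q * \<alpha> - of_int p\<bar> \<le> 1"
    using large mult_left_mono[OF large, of "\<bar>of_int q * \<alpha> - of_int p\<bar>"] by simp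
  hence small: "cmod (of_int q * of_real \<alpha> - of_int p) \<le> 1"
    by (metis norm_of_real of_real_diff of_real_mult of_real_of_int_eq)
  \<comment> \<open>Of the 2 in \<open>far\<close>, at most 1 is lost when
    \<open>q * \<alpha>\<close> is replaced by \<open>p\<close>, which leaves more than 1.\<close>
  have "2 < of_nat n * cmod (y - of_real \<alpha>)" by (rule far) fact
  also have "\<dots> \<le> of_int q * cmod (y - of_real \<alpha>)"
    using q by (intro mult_right_mono) auto
  also have "\<dots> = cmod (of_int q * (y - of_real \<alpha>))"
    using q by (simp add: norm_mult)
  also have "of_int q * (y - of_real \<alpha>) =
      (of_int q * y - of_int p) - (of_int q * of_real \<alpha> - of_int p)"
    by (simp add: algebra_simps)
  also have "cmod \<dots> \<le> cmod (of_int q * y - of_int p) + 1"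
    using norm_triangle_ineq4[of "of_int q * y - of_int p" "of_int q * of_real \<alpha> - of_int p"] small
    by linarith
  finally have gt1: "cmod (of_int q * y - of_int p) > 1" by simp
  have "cmod (of_int q * y - of_int p) * cmod (of_int q * z + of_int q') = 1"
    by (rule moebius_norm_mult_eq_1[OF y(2) det])
  with gt1 have "cmod (of_int q * z + of_int q') < 1"
    using mult_left_mono[of 1 "cmod (of_int q * z + of_int q')" "cmod (of_int q * y - of_int p)"]
    by fastforce
  \<comment> \<open>Recentring from \<open>- q' / q\<close> to \<open>- 1 / 2\<close>, scaled by
    \<open>q\<close>: the distance is below \<open>1 + (q / 2 - 1) = q / 2\<close>, because
    \<open>q'\<close> lies between 1 and \<open>q - 1\<close>.\<close>
  moreover have "of_int q * (z + 1 / 2) =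
      (of_int q * z + of_int q') + of_real (of_int q / 2 - of_int q')"
    by (simp add: algebra_simps)
  hence "cmod (of_int q * (z + 1 / 2)) \<le>
      cmod (of_int q * z + of_int q') + \<bar>of_int q / 2 - of_int q'\<bar>"
    by (metis norm_of_real norm_triangle_ineq)
  moreover have "\<bar>of_int q / 2 - of_int q'\<bar> \<le> of_int q / 2 - (1 :: real)"
  proof -
    have "real_of_int q' \<ge> 1" "real_of_int q' + 1 \<le> of_int q" using q by linarith+
    thus ?thesis by linarith
  qed
  moreover have "cmod (of_int q * (z + 1 / 2)) = of_int q * cmod (z + 1 / 2)"
    using q by (simp add: norm_mult)
  ultimately have "of_int q * cmod (z + 1 / 2) < of_int q * (1 / 2)" by linarith
  thus ?thesis using q by (subst (asm) mult_less_cancel_left_pos) simp_all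
qed

section \<open>Reducedness from some index on\<close>

lemma finite_other_conjugates:
  assumes "algebraic \<alpha>"
  shows "finite (other_conjugates \<alpha>)"
proof -
  have "int_minpoly \<alpha> \<noteq> 0"
    using is_int_minpoly_int_minpoly[OF assms] by (auto simp: is_int_minpoly_def)
  hence "map_poly of_int (int_minpoly \<alpha>) \<noteq> (0 :: complex poly)"
    by (simp add: map_poly_eq_0_iff)
  thus ?thesis unfolding other_conjugates_def by (intro finite_Diff poly_roots_finite)
qed

text \<open>The conjugates are finitely many and each has positive distance from \<alpha>, so one
  threshold serves them all.\<close>

lemma eventually_reduced_irrationality:
  assumes "algebraic \<alpha>" "\<alpha> \<notin> \<rat>"
  shows "\<exists>n\<^sub>0. \<forall>n\<ge>n\<^sub>0. reduced_irrationality \<alpha> (complete_quotient \<alpha> n)"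
proof -
  have "\<exists>m. \<forall>n\<ge>m. of_nat n * cmod (y - of_real \<alpha>) > 2" if "y \<in> other_conjugates \<alpha>" for y
  proof -
    have pos: "cmod (y - of_real \<alpha>) > 0" using that by (simp add: other_conjugates_def)
    then obtain m where m: "of_nat m * cmod (y - of_real \<alpha>) > 2"
      using reals_Archimedean3 by blast
    show ?thesis
      using m pos by (intro exI[of _ m]) (auto intro: less_le_trans mult_right_mono)
  qed
  then obtain m where m: "\<And>y n. y \<in> other_conjugates \<alpha> \<Longrightarrow> n \<ge> m y \<Longrightarrow>
      of_nat n * cmod (y - of_real \<alpha>) > 2"
    by metis
  obtain M where M: "\<And>y. y \<in> other_conjugates \<alpha> \<Longrightarrow> m y \<le> M"
    using finite_other_conjugates[OF assms(1)] by (metis Max_ge finite_imageI imageI)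
  \<comment> \<open>The offset 4 matches the index \<open>n + 4\<close> in
    \<open>conjugate_in_disk\<close>.\<close>
  have "reduced_irrationality \<alpha> (complete_quotient \<alpha> n)" if n: "n \<ge> M + 4" for n
  proof -
    obtain k where k: "n = k + 4" "k \<ge> M" using n that[of "n - 4"] by simp
    show ?thesis
    proof (rule reduced_irrationality_complete_quotient)
      show "complete_quotient \<alpha> n > 1"
        using complete_quotient_gt_1[OF assms(2), of "k + 3"] k by (simp add: numeral_eq_Suc)
      fix z assume "z \<in> other_conjugates (complete_quotient \<alpha> n)"
      thus "cmod (z + 1 / 2) < 1 / 2"
        using conjugate_in_disk[OF assms, of z k] m M k by (meson order_trans)
    qed (use assms k in auto)
  qed
  thus ?thesis by blast
qed

theorem theorem1:
  fixes \<alpha> :: real and N :: nat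
  assumes "algebraic \<alpha>" and "algebraic_degree \<alpha> = N" and "N > 1"
  shows "(\<forall>n\<ge>1. algebraic (complete_quotient \<alpha> n) \<and>
              algebraic_discriminant (complete_quotient \<alpha> n) = algebraic_discriminant \<alpha>) \<and>
         (reduced_irrationality \<alpha> \<alpha> \<longrightarrow>
              (\<forall>n\<ge>1. reduced_irrationality \<alpha> (complete_quotient \<alpha> n))) \<and>
         (\<exists>n\<^sub>0. \<forall>n\<ge>n\<^sub>0. reduced_irrationality \<alpha> (complete_quotient \<alpha> n))"
proof -
  have irrat: "\<alpha> \<notin> \<rat>"
    using assms by (intro irrational_if_algebraic_degree_gt_1) simp_all
  have "reduced_irrationality \<alpha> (complete_quotient \<alpha> n)"
    if "reduced_irrationality \<alpha> \<alpha>" "n \<ge> 1" for n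
    using that(2)
  proof (induction n rule: dec_induct)
    case base
    show ?case using that(1) by (simp add: complete_quotient_1 del: One_nat_def)
  next
    case (step n)
    thus ?case using reduced_irrationality_complete_quotient_Suc assms(1) irrat by blast
  qed
  thus ?thesis
    using algebraic_complete_quotient[OF assms(1) irrat]
      eventually_reduced_irrationality[OF assms(1) irrat] by blast
qed

end
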